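(* Let $q$ be a prime power, $d\ge 2$ an integer and $f=x^d\in\mathbb{F}_q[x]$. Then \[\deg(S_f)\le \max\Big(\gcd(d,q-1),\ 1+\gcd(d-1,q-1),\ \big\lfloor \tfrac12+\sqrt{q-1}\big\rfloor\Big).\] In particular, if $\lfloor \frac12+\sqrt{q-1}\rfloor\le \max(\gcd(d,q-1),1+\gcd(d-1,q-1))$, then $\deg(S_f)=\max(\gcd(d,q-1),1+\gcd(d-1,q-1))$.
   Context: $\mathrm{PG}(2,q)$ is the projective plane over $\mathbb{F}_q$. For $f\in\mathbb{F}_q[x]$, $S_f=\{(x,f(x),1):x\in\mathbb{F}_q\}\cup\{(0,1,0)\}$. For a set $D$ of $q+1$ points, $u_i(D)$ is the number of lines of $\mathrm{PG}(2,q)$ containing exactly $i$ points of $D$, and $\deg(D)$ is the largest $i$ with $u_i(D)\neq 0$. *)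

theory Defs
  imports "HOL-Analysis.Analysis" "HOL-Computational_Algebra.Polynomial"
begin

text \<open>
  The projective plane over a field: points and lines are the subspaces of dimension 1 and 2 of the
  three-dimensional coordinate space; a point lies on a line iff it is contained in it.
\<close>

definition pg_points :: "('a::field ^ 3) set set" where
  "pg_points = {P. vec.subspace P \<and> vec.dim P = 1}"

definition pg_lines :: "('a::field ^ 3) set set" where
  "pg_lines = {l. vec.subspace l \<and> vec.dim l = 2}"

definition pg_pt :: "'a::field \<Rightarrow> 'a \<Rightarrow> 'a \<Rightarrow> ('a ^ 3) set" where
  "pg_pt x y z = vec.span {vector [x, y, z]}"

definition S_set :: "'a::field poly \<Rightarrow> ('a ^ 3) set set" where
  "S_set f = {pg_pt x (poly f x) 1 | x. True} \<union> {pg_pt 0 1 0}"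

definition u_num :: "nat \<Rightarrow> ('a::field ^ 3) set set \<Rightarrow> nat" where
  "u_num i D = card {l \<in> pg_lines. card {P \<in> D. P \<subseteq> l} = i}"

text \<open>
  Over a finite field the maximum below is taken over a finite nonempty set
  (\<open>finite_u_num_nonzero\<close>, \<open>u_num_nonzero_nonempty\<close>).
\<close>

definition deg_set :: "('a::{field,finite} ^ 3) set set \<Rightarrow> nat" where
  "deg_set D = Max {i. u_num i D \<noteq> 0}"

lemma u_num_nonzero_eq:
  fixes D :: "('a::{field,finite} ^ 3) set set"
  shows "{i. u_num i D \<noteq> 0} = (\<lambda>l. card {P \<in> D. P \<subseteq> l}) ` pg_lines"
  by (auto simp: u_num_def)

lemma finite_u_num_nonzero:
  fixes D :: "('a::{field,finite} ^ 3) set set"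
  shows "finite {i. u_num i D \<noteq> 0}"
  unfolding u_num_nonzero_eq by simp

lemma pg_lines_nonempty: "(pg_lines :: ('a::field ^ 3) set set) \<noteq> {}"
proof -
  have "2 \<le> vec.dim (UNIV :: ('a ^ 3) set)"
    by (simp add: card_cart_basis)
  then obtain T :: "('a ^ 3) set" where "vec.subspace T" "vec.dim T = 2"
    using vec.choose_subspace_of_subspace[of 2 "UNIV :: ('a ^ 3) set"] by blast
  then show ?thesis
    by (auto simp: pg_lines_def)
qed

lemma u_num_nonzero_nonempty:
  fixes D :: "('a::{field,finite} ^ 3) set set"
  shows "{i. u_num i D \<noteq> 0} \<noteq> {}"
  unfolding u_num_nonzero_eq using pg_lines_nonempty by simp

lemma pg_pt_in_pg_points:
  assumes "(x, y, z) \<noteq> (0, 0, 0)"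
  shows "pg_pt x y z \<in> pg_points"
proof -
  have "vector [x, y, z] \<noteq> (0 :: 'a ^ 3)"
    using assms by (auto simp: vec_eq_iff forall_3)
  then show ?thesis
    by (simp add: pg_points_def pg_pt_def vec.dim_span vec.subspace_span
        vec.dim_eq_card_independent vec.independent_insert)
qed

lemma pg_pt_eqD:
  assumes "pg_pt x y z = pg_pt x' y' z'"
  obtains c where "x = c * x'" "y = c * y'" "z = c * z'"
proof -
  have "vector [x, y, z] \<in> vec.span {vector [x', y', z'] :: 'a ^ 3}"
    using assms unfolding pg_pt_def by (metis insertI1 vec.span_base)
  then obtain c where "vector [x, y, z] = c *s (vector [x', y', z'] :: 'a ^ 3)"
    by (auto simp: vec.span_singleton)
  then show ?thesis
    using that[of c] by (auto simp: vec_eq_iff forall_3)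
qed

lemma S_set_subset_pg_points: "S_set f \<subseteq> pg_points"
  by (auto simp: S_set_def intro!: pg_pt_in_pg_points)

lemma card_S_set:
  fixes f :: "'a::{field,finite} poly"
  shows "card (S_set f) = CARD('a) + 1"
proof -
  have "inj (\<lambda>x. pg_pt x (poly f x) 1)"
    by (rule injI) (metis pg_pt_eqD mult_1 mult.right_neutral)
  moreover have "pg_pt 0 1 0 \<notin> range (\<lambda>x. pg_pt x (poly f x) 1)"
    by (auto elim!: pg_pt_eqD)
  moreover have "S_set f = insert (pg_pt 0 1 0) (range (\<lambda>x. pg_pt x (poly f x) 1))"
    by (auto simp: S_set_def)
  ultimately show ?thesis
    by (simp add: card_image)
qed

end

theory Submission
  imports Defs
begin

text \<open>
  The lines that miss \<open>(0, 1, 0)\<close> are the lines \<open>y = m x + b z\<close>, and a line through \<open>(0, 1, 0)\<close> has at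
  most two points of \<open>S\<^sub>f\<close>; so \<open>deg(S\<^sub>f)\<close> is the largest number of roots of an equation
  \<open>f(x) = m x + b\<close>. For \<open>f = x\<^sup>d\<close> the cases \<open>m = 0\<close> and \<open>b = 0\<close> amount to counting roots of unity. If
  \<open>m, b \<noteq> 0\<close>, then for each \<open>u \<noteq> 1\<close> at most one root \<open>x\<close> has \<open>u x\<close> as another root: eliminating
  \<open>x\<^sup>d\<close> gives \<open>m (u\<^sup>d - u) x = b (1 - u\<^sup>d)\<close>, and \<open>u\<^sup>d - u\<close> and \<open>1 - u\<^sup>d\<close> do not both vanish. Hence \<open>k\<close>
  roots have \<open>k (k - 1)\<close> distinct quotients different from \<open>0\<close> and \<open>1\<close>, so \<open>k (k - 1) \<le> q - 2\<close>.
\<close>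

subsection \<open>Power equations in finite fields\<close>

lemma two_le_CARD: "2 \<le> CARD('a::{zero_neq_one,finite})"
  using card_mono[of UNIV "{0, 1::'a}"] by simp

lemma card_nonzero: "card (- {0::'a::{zero,finite}}) = CARD('a) - 1"
  by (simp add: Compl_eq_Diff_UNIV card_Diff_subset)

text \<open>
  The library's \<open>finite_field_power_card_eq_same\<close> requires the class \<open>finite_field\<close>, which the sort
  \<open>{field, finite}\<close> does not entail.
\<close>

lemma power_CARD_minus_1_eq_1:
  fixes x :: "'a::{field,finite}"
  assumes "x \<noteq> 0"
  shows "x ^ (CARD('a) - 1) = 1"
proof -
  have "\<Prod>(- {0::'a}) = (\<Prod>y\<in>- {0}. x * y)"
    using assms by (intro prod.reindex_bij_witness[of _ "\<lambda>y. x * y" "\<lambda>y. y / x"]) auto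
  also have "\<dots> = x ^ (CARD('a) - 1) * \<Prod>(- {0})"
    by (simp add: prod.distrib card_nonzero)
  finally show ?thesis
    by simp
qed

lemma power_gcd_eq_1_iff:
  fixes x :: "'a::monoid_mult"
  shows "x ^ gcd m n = 1 \<longleftrightarrow> x ^ m = 1 \<and> x ^ n = 1"
proof
  assume "x ^ gcd m n = 1"
  then show "x ^ m = 1 \<and> x ^ n = 1"
    by (metis dvdE gcd_dvd1 gcd_dvd2 power_mult power_one)
next
  assume powers: "x ^ m = 1 \<and> x ^ n = 1"
  show "x ^ gcd m n = 1"
  proof (cases "m = 0")
    case False
    then obtain s t where "m * s = n * t + gcd m n"
      using bezout_nat by blast
    then have "(x ^ m) ^ s = (x ^ n) ^ t * x ^ gcd m n"
      by (metis power_add power_mult)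
    with powers show ?thesis
      by simp
  qed (use powers in simp)
qed

lemma
  fixes a :: "'a::idom"
  assumes "n > 0"
  shows finite_power_eq: "finite {x. x ^ n = a}"
    and card_power_eq_le: "card {x. x ^ n = a} \<le> n"
proof -
  let ?p = "monom 1 n - [:a:]"
  have roots: "{x. poly ?p x = 0} = {x. x ^ n = a}"
    by (simp add: poly_monom)
  have "coeff ?p n = 1"
    using assms by (simp add: coeff_pCons split: nat.split)
  then have "?p \<noteq> 0"
    by (metis coeff_0 zero_neq_one)
  then have "finite {x. poly ?p x = 0}" "card {x. poly ?p x = 0} \<le> degree ?p"
    by (rule poly_roots_finite, rule card_poly_roots_bound)
  moreover have "degree ?p \<le> n"
    by (intro degree_diff_le) (auto simp: degree_monom_eq)
  ultimately show "finite {x. x ^ n = a}" "card {x. x ^ n = a} \<le> n"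
    unfolding roots by simp_all
qed

lemma card_power_eq_le_card_roots_of_unity:
  fixes a :: "'a::field"
  assumes "n > 0"
  shows "card {x. x ^ n = a} \<le> card {x::'a. x ^ n = 1}"
proof (cases "\<exists>y. y \<noteq> 0 \<and> y ^ n = a")
  case True
  then obtain y where "y \<noteq> 0" "y ^ n = a"
    by blast
  then show ?thesis
    using assms
    by (intro card_inj_on_le[of "\<lambda>x. x / y"] finite_power_eq)
      (auto simp: inj_on_def power_divide)
next
  case False
  then have "{x. x ^ n = a} \<subseteq> {0}"
    by blast
  then have "card {x. x ^ n = a} \<le> card {1::'a}"
    using card_mono[of "{0::'a}"] by simp
  also have "\<dots> \<le> card {x::'a. x ^ n = 1}"
    using assms by (intro card_mono finite_power_eq) auto
  finally show ?thesis .
qed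

text \<open>
  With \<open>q - 1 = n k\<close>, the \<open>n\<close>-th power map sends the nonzero elements to the at most \<open>k\<close> solutions
  of \<open>y\<^sup>k = 1\<close>, and no fibre is larger than the one over \<open>1\<close>, which has at most \<open>n\<close> elements.
\<close>

lemma card_roots_of_unity_dvd:
  assumes "n dvd CARD('a::{field,finite}) - 1"
  shows "card {x::'a. x ^ n = 1} = n"
proof -
  obtain k where cofactor: "CARD('a) - 1 = n * k"
    using assms by blast
  then have pos: "n > 0" "k > 0"
    using two_le_CARD[where 'a='a] by (auto intro!: Nat.gr0I)
  let ?U = "\<lambda>j. {x::'a. x ^ j = 1}"
  have "(x ^ n) ^ k = 1" if "x \<noteq> 0" for x :: 'a
    using power_CARD_minus_1_eq_1[OF that] by (simp only: cofactor power_mult)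
  then have covering: "- {0} \<subseteq> (\<Union>y\<in>?U k. {x. x ^ n = y})"
    by auto
  have "n * k = card (- {0::'a})"
    by (simp only: card_nonzero cofactor)
  also have "\<dots> \<le> card (\<Union>y\<in>?U k. {x. x ^ n = y})"
    using covering by (rule card_mono[rotated]) simp
  also have "\<dots> \<le> (\<Sum>y\<in>?U k. card {x. x ^ n = y})"
    by (rule card_UN_le) simp
  also have "\<dots> \<le> card (?U k) * card (?U n)"
    using sum_bounded_above[of "?U k" "\<lambda>y. card {x. x ^ n = y}" "card (?U n)"]
      card_power_eq_le_card_roots_of_unity[OF pos(1), where 'a='a] by simp
  also have "\<dots> \<le> k * card (?U n)"
    by (intro mult_right_mono card_power_eq_le pos) simp
  finally have "n \<le> card (?U n)"
    using pos(2) by simp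
  then show ?thesis
    by (intro antisym card_power_eq_le pos)
qed

lemma card_roots_of_unity:
  assumes "n > 0"
  shows "card {x::'a::{field,finite}. x ^ n = 1} = gcd n (CARD('a) - 1)"
proof -
  have "x ^ n = 1 \<longleftrightarrow> x ^ gcd n (CARD('a) - 1) = 1" for x :: 'a
    using assms power_CARD_minus_1_eq_1[of x]
    by (cases "x = 0") (auto simp: power_gcd_eq_1_iff power_0_left)
  then show ?thesis
    using card_roots_of_unity_dvd[of "gcd n (CARD('a) - 1)", where 'a='a] by simp
qed

lemma card_power_eq_le_gcd:
  fixes a :: "'a::{field,finite}"
  assumes "n > 0"
  shows "card {x. x ^ n = a} \<le> gcd n (CARD('a) - 1)"
  using card_power_eq_le_card_roots_of_unity[OF assms, of a] by (simp add: card_roots_of_unity assms)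

lemma power_eq_mult_self_roots:
  fixes m :: "'a::idom"
  assumes "d \<ge> 2"
  shows "{x. x ^ d = m * x} = insert 0 {x. x ^ (d - 1) = m}"
proof -
  have "x ^ d = x ^ (d - 1) * x" for x :: 'a
    using assms by (intro power_minus_mult[symmetric]) simp
  then show ?thesis
    by auto
qed

lemma card_power_eq_mult_self_le:
  fixes m :: "'a::{field,finite}"
  assumes "d \<ge> 2"
  shows "card {x. x ^ d = m * x} \<le> 1 + gcd (d - 1) (CARD('a) - 1)"
proof -
  have "card {x. x ^ d = m * x} \<le> 1 + card {x. x ^ (d - 1) = m}"
    unfolding power_eq_mult_self_roots[OF assms] by (simp add: card_insert_if)
  also have "\<dots> \<le> 1 + gcd (d - 1) (CARD('a) - 1)"
    using assms by (intro add_left_mono card_power_eq_le_gcd) simp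
  finally show ?thesis .
qed

lemma card_power_eq_self:
  assumes "d \<ge> 2"
  shows "card {x::'a::{field,finite}. x ^ d = x} = 1 + gcd (d - 1) (CARD('a) - 1)"
  using assms power_eq_mult_self_roots[OF assms, of "1::'a"]
  by (simp add: power_0_left card_roots_of_unity)

subsection \<open>Roots of \<open>x\<^sup>d = m x + b\<close>\<close>

lemma power_eq_linear_ratio_unique:
  fixes m b u x y :: "'a::idom"
  assumes "m \<noteq> 0" "b \<noteq> 0" "u \<noteq> 1"
    and x_roots: "x ^ d = m * x + b" "(u * x) ^ d = m * (u * x) + b"
    and y_roots: "y ^ d = m * y + b" "(u * y) ^ d = m * (u * y) + b"
  shows "x = y"
proof -
  have eliminated: "m * (u ^ d - u) * z = b * (1 - u ^ d)"
    if "z ^ d = m * z + b" "(u * z) ^ d = m * (u * z) + b" for z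
  proof -
    have "u ^ d * (m * z + b) = m * (u * z) + b"
      using that by (simp add: power_mult_distrib)
    then show ?thesis
      by (simp add: algebra_simps)
  qed
  have "u ^ d \<noteq> u"
    using eliminated[OF x_roots] assms(2,3) by auto
  moreover have "m * (u ^ d - u) * x = m * (u ^ d - u) * y"
    using eliminated[OF x_roots] eliminated[OF y_roots] by simp
  ultimately show ?thesis
    using assms(1) by simp
qed

lemma card_ratio_unique_le:
  fixes R :: "'a::{field,finite} set"
  assumes "0 \<notin> R"
    and ratio_unique:
      "\<And>u x y. u \<noteq> 1 \<Longrightarrow> x \<in> R \<Longrightarrow> u * x \<in> R \<Longrightarrow> y \<in> R \<Longrightarrow> u * y \<in> R \<Longrightarrow> x = y"
  shows "card R * (card R - 1) \<le> CARD('a) - 2"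
proof -
  let ?P = "SIGMA x:R. R - {x}"
  have "inj_on (\<lambda>(x, y). y / x) ?P"
  proof (rule inj_onI)
    fix p p'
    assume "p \<in> ?P" "p' \<in> ?P" "(\<lambda>(x, y). y / x) p = (\<lambda>(x, y). y / x) p'"
    then obtain x y x' y' where pairs: "p = (x, y)" "p' = (x', y')"
      and in_R: "x \<in> R" "y \<in> R" "x' \<in> R" "y' \<in> R" and "y \<noteq> x" and quotients: "y / x = y' / x'"
      by auto
    define u where "u = y / x"
    have "x \<noteq> 0" "x' \<noteq> 0"
      using in_R assms(1) by auto
    then have "y = u * x" "y' = u * x'" "u \<noteq> 1"
      using \<open>y \<noteq> x\<close> quotients unfolding u_def by (auto simp: field_simps)
    then show "p = p'"
      using ratio_unique[of u x x'] in_R pairs by simp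
  qed
  moreover have "(\<lambda>(x, y). y / x) ` ?P \<subseteq> - {0, 1}"
    using assms(1) by auto
  ultimately have "card ?P \<le> card (- {0, 1::'a})"
    by (intro card_inj_on_le) auto
  then show ?thesis
    by (simp add: Compl_eq_Diff_UNIV card_Diff_subset)
qed

lemma card_power_eq_linear_mult_le:
  fixes m b :: "'a::{field,finite}"
  assumes "m \<noteq> 0" "b \<noteq> 0" "d > 0"
  shows "card {x. x ^ d = m * x + b} * (card {x. x ^ d = m * x + b} - 1) \<le> CARD('a) - 2"
proof (rule card_ratio_unique_le)
  show "0 \<notin> {x. x ^ d = m * x + b}"
    using assms by (simp add: power_0_left)
qed (auto intro: power_eq_linear_ratio_unique[OF assms(1,2)])

lemma le_floor_half_plus_sqrt:
  fixes k n :: nat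
  assumes "k * (k - 1) \<le> n"
  shows "int k \<le> \<lfloor>1 / 2 + sqrt (real n + 1)\<rfloor>"
proof (cases k)
  case (Suc j)
  have "real (k * j) \<le> real n"
    using assms Suc by (simp only: of_nat_le_iff diff_Suc_1)
  then have "(real k - 1 / 2)\<^sup>2 \<le> real n + 1"
    using Suc by (simp add: power2_eq_square algebra_simps)
  then have "real k - 1 / 2 \<le> sqrt (real n + 1)"
    by (rule real_le_rsqrt)
  then show ?thesis
    by (simp add: le_floor_iff)
qed simp

lemma card_power_eq_linear_le:
  fixes m b :: "'a::{field,finite}"
  assumes "d \<ge> 2"
  shows "int (card {x. x ^ d = m * x + b})
    \<le> max (int (max (gcd d (CARD('a) - 1)) (1 + gcd (d - 1) (CARD('a) - 1))))
          \<lfloor>1 / 2 + sqrt (real CARD('a) - 1)\<rfloor>"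
proof -
  consider (horizontal) "m = 0" | (through_origin) "b = 0" | (trinomial) "m \<noteq> 0" "b \<noteq> 0"
    by blast
  then show ?thesis
  proof cases
    case horizontal
    then show ?thesis
      using card_power_eq_le_gcd[of d b] assms by simp
  next
    case through_origin
    then show ?thesis
      using card_power_eq_mult_self_le[OF assms, of m] by (simp add: le_max_iff_disj)
  next
    case trinomial
    then have "int (card {x. x ^ d = m * x + b}) \<le> \<lfloor>1 / 2 + sqrt (real (CARD('a) - 2) + 1)\<rfloor>"
      using assms by (intro le_floor_half_plus_sqrt card_power_eq_linear_mult_le) auto
    then show ?thesis
      using two_le_CARD[where 'a='a] by (simp add: of_nat_diff)
  qed
qed

subsection \<open>Lines and the set \<open>S\<^sub>f\<close>\<close>

lemma pg_lines_iff_complement: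
  fixes l :: "('a::field ^ 3) set"
  assumes "vec.subspace l" "p \<notin> l"
  shows "l \<in> pg_lines \<longleftrightarrow> (\<forall>v. \<exists>k. v - k *s p \<in> l)"
proof -
  have span: "vec.span l = l"
    using assms(1) by (simp add: vec.span_eq_iff)
  have "l \<in> pg_lines \<longleftrightarrow> vec.dim (insert p l) = 3"
    using assms by (simp add: pg_lines_def vec.dim_insert span)
  also have "\<dots> \<longleftrightarrow> vec.span (insert p l) = UNIV"
    using vec.dim_eq_full[of "insert p l"] by (simp add: vec.dimension_def card_cart_basis)
  also have "\<dots> \<longleftrightarrow> (\<forall>v. \<exists>k. v - k *s p \<in> l)"
    by (auto simp: vec.span_insert span)
  finally show ?thesis .
qed

definition graph_line :: "'a::field \<Rightarrow> 'a \<Rightarrow> ('a ^ 3) set" where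
  "graph_line m b = {v. v $ 2 = m * v $ 1 + b * v $ 3}"

lemma subspace_graph_line: "vec.subspace (graph_line m b)"
  by (auto simp: graph_line_def vec.subspace_def algebra_simps)

lemma graph_line_in_pg_lines: "graph_line m b \<in> pg_lines"
proof -
  have "v - (v $ 2 - m * v $ 1 - b * v $ 3) *s vector [0, 1, 0] \<in> graph_line m b" for v
    by (simp add: graph_line_def)
  moreover have "vector [0, 1, 0] \<notin> graph_line m b"
    by (simp add: graph_line_def)
  ultimately show ?thesis
    using pg_lines_iff_complement[OF subspace_graph_line] by blast
qed

lemma pg_line_eq_graph_line:
  fixes l :: "('a::field ^ 3) set"
  assumes "l \<in> pg_lines" "vector [0, 1, 0] \<notin> l"
  obtains m b where "l = graph_line m b"
proof -
  let ?e = "vector [0, 1, 0] :: 'a ^ 3"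
  have subspace: "vec.subspace l"
    using assms(1) by (simp add: pg_lines_def)
  have complement: "\<exists>k. v - k *s ?e \<in> l" for v
    using assms subspace pg_lines_iff_complement by blast
  obtain m where x_axis: "vector [1, 0, 0] - m *s ?e \<in> l"
    using complement by blast
  obtain b where z_axis: "vector [0, 0, 1] - b *s ?e \<in> l"
    using complement by blast
  have "graph_line (- m) (- b) \<subseteq> l"
  proof
    fix v
    assume "v \<in> graph_line (- m) (- b)"
    then have "v = v $ 1 *s (vector [1, 0, 0] - m *s ?e) + v $ 3 *s (vector [0, 0, 1] - b *s ?e)"
      by (simp add: graph_line_def vec_eq_iff forall_3)
    also have "\<dots> \<in> l"
      by (intro vec.subspace_add vec.subspace_scale subspace x_axis z_axis)
    finally show "v \<in> l" .
  qed
  then have "graph_line (- m) (- b) = l"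
    using assms(1) graph_line_in_pg_lines[of "- m" "- b"]
    by (intro vec.subspace_dim_equal) (auto simp: pg_lines_def)
  then show ?thesis
    using that by metis
qed

lemma pg_pt_subset_iff:
  assumes "vec.subspace l"
  shows "pg_pt x y z \<subseteq> l \<longleftrightarrow> vector [x, y, z] \<in> l"
  unfolding pg_pt_def
  using assms vec.span_minimal[of "{vector [x, y, z]}" l] vec.span_superset[of "{vector [x, y, z]}"]
  by auto

lemma card_S_set_line:
  fixes f :: "'a::{field,finite} poly"
  assumes "vec.subspace l"
  shows "card {P \<in> S_set f. P \<subseteq> l}
    = card {x. vector [x, poly f x, 1] \<in> l} + of_bool (vector [0, 1, 0] \<in> l)"
proof -
  let ?g = "\<lambda>x. pg_pt x (poly f x) 1"
  let ?X = "{x. vector [x, poly f x, 1] \<in> l}"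
  let ?Y = "{P. P = pg_pt 0 1 0 \<and> vector [0, 1, 0] \<in> l}"
  have "{P \<in> S_set f. P \<subseteq> l} = ?g ` ?X \<union> ?Y"
    using pg_pt_subset_iff[OF assms] by (auto simp: S_set_def)
  moreover have "?g ` ?X \<inter> ?Y = {}"
    by (auto elim!: pg_pt_eqD)
  moreover have "inj_on ?g ?X"
    by (rule inj_onI) (metis pg_pt_eqD mult_1 mult.right_neutral)
  ultimately show ?thesis
    by (simp add: card_Un_disjoint card_image)
qed

lemma card_S_set_graph_line:
  fixes f :: "'a::{field,finite} poly"
  shows "card {P \<in> S_set f. P \<subseteq> graph_line m b} = card {x. poly f x = m * x + b}"
  unfolding card_S_set_line[OF subspace_graph_line] by (simp add: graph_line_def)

lemma card_S_set_vertical_line_le_2: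
  fixes f :: "'a::{field,finite} poly"
  assumes "l \<in> pg_lines" "vector [0, 1, 0] \<in> l"
  shows "card {P \<in> S_set f. P \<subseteq> l} \<le> 2"
proof -
  have subspace: "vec.subspace l" and "vec.dim l = 2"
    using assms(1) by (auto simp: pg_lines_def)
  then have "l \<noteq> UNIV"
    by (auto simp: card_cart_basis)
  have "x = x'" if on_line: "vector [x, y, 1] \<in> l" "vector [x', y', 1] \<in> l" for x x' y y'
  proof (rule ccontr)
    assume "x \<noteq> x'"
    have "v \<in> l" for v
    proof -
      define s where "s = (v $ 1 - x' * v $ 3) / (x - x')"
      define t where "t = v $ 3 - s"
      have "s * (x - x') = v $ 1 - x' * v $ 3"
        using \<open>x \<noteq> x'\<close> by (simp add: s_def)
      then have "v = s *s vector [x, y, 1] + t *s vector [x', y', 1]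
          + (v $ 2 - s * y - t * y') *s vector [0, 1, 0]"
        by (simp add: vec_eq_iff forall_3 t_def algebra_simps)
      also have "\<dots> \<in> l"
        by (intro vec.subspace_add vec.subspace_scale subspace on_line assms(2))
      finally show "v \<in> l" .
    qed
    with \<open>l \<noteq> UNIV\<close> show False
      by blast
  qed
  then have "card {x. vector [x, poly f x, 1] \<in> l} \<le> 1"
    by (simp add: card_le_Suc0_iff_eq)
  then show ?thesis
    using assms(2) by (simp add: card_S_set_line[OF subspace])
qed

lemma card_line_le_deg_set:
  assumes "l \<in> pg_lines"
  shows "card {P \<in> D. P \<subseteq> l} \<le> deg_set D"
  unfolding deg_set_def using assms
  by (intro Max_ge finite_u_num_nonzero) (auto simp only: u_num_nonzero_eq)

lemma deg_set_attained:
  obtains l where "l \<in> pg_lines" "deg_set D = card {P \<in> D. P \<subseteq> l}"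
  using Max_in[OF finite_u_num_nonzero u_num_nonzero_nonempty, of D]
  unfolding deg_set_def u_num_nonzero_eq by blast

theorem deg_set_S_set:
  fixes f :: "'a::{field,finite} poly"
  shows "deg_set (S_set f) = Max (range (\<lambda>(m, b). card {x. poly f x = m * x + b}))"
    (is "_ = Max ?N")
proof (rule antisym)
  obtain l :: "('a ^ 3) set" where line: "l \<in> pg_lines"
    and attained: "deg_set (S_set f) = card {P \<in> S_set f. P \<subseteq> l}"
    using deg_set_attained by blast
  show "deg_set (S_set f) \<le> Max ?N"
  proof (cases "vector [0, 1, 0] \<in> l")
    case True
    let ?b = "poly f 0" and ?m = "poly f 1 - poly f 0"
    have "deg_set (S_set f) \<le> card {0, 1::'a}"
      using card_S_set_vertical_line_le_2[OF line True, of f] attained by simp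
    also have "\<dots> \<le> card {x. poly f x = ?m * x + ?b}"
      by (intro card_mono) auto
    also have "\<dots> \<le> Max ?N"
      by (intro Max_ge) auto
    finally show ?thesis .
  next
    case False
    then obtain m b where "l = graph_line m b"
      using pg_line_eq_graph_line line by blast
    then show ?thesis
      using attained by (intro Max_ge) (auto simp: card_S_set_graph_line)
  qed
  have "card {x. poly f x = m * x + b} \<le> deg_set (S_set f)" for m b
    by (simp flip: card_S_set_graph_line add: card_line_le_deg_set graph_line_in_pg_lines)
  then show "Max ?N \<le> deg_set (S_set f)"
    by (intro Max.boundedI) auto
qed

theorem theorem3p24:
  fixes d q :: nat
  assumes "q = CARD('a::{field,finite})"
    and "d \<ge> 2"
  shows "int (deg_set (S_set (monom (1::'a) d)))
           \<le> max (int (max (gcd d (q - 1)) (1 + gcd (d - 1) (q - 1))))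
                 \<lfloor>1 / 2 + sqrt (real q - 1)\<rfloor>
         \<and> (\<lfloor>1 / 2 + sqrt (real q - 1)\<rfloor>
              \<le> int (max (gcd d (q - 1)) (1 + gcd (d - 1) (q - 1)))
            \<longrightarrow> deg_set (S_set (monom (1::'a) d))
                  = max (gcd d (q - 1)) (1 + gcd (d - 1) (q - 1)))"
proof -
  let ?deg = "deg_set (S_set (monom (1::'a) d))"
  let ?N = "range (\<lambda>(m, b). card {x::'a. x ^ d = m * x + b})"
  have deg: "?deg = Max ?N"
    by (simp add: deg_set_S_set poly_monom)
  have card_le_deg: "card {x::'a. x ^ d = m * x + b} \<le> ?deg" for m b
    unfolding deg by (intro Max_ge) auto
  have "?deg \<in> ?N"
    unfolding deg by (intro Max_in) auto
  then obtain m b where "?deg = card {x::'a. x ^ d = m * x + b}"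
    by auto
  then have "int ?deg \<le> max (int (max (gcd d (q - 1)) (1 + gcd (d - 1) (q - 1))))
      \<lfloor>1 / 2 + sqrt (real q - 1)\<rfloor>"
    using card_power_eq_linear_le[OF assms(2)] assms(1) by simp
  moreover have "gcd d (q - 1) \<le> ?deg"
    using card_le_deg[of 0 1] card_roots_of_unity[of d, where 'a='a] assms by simp
  moreover have "1 + gcd (d - 1) (q - 1) \<le> ?deg"
    using card_le_deg[of 1 0] card_power_eq_self[OF assms(2), where 'a='a] assms(1) by simp
  ultimately show ?thesis
    by linarith
qed

end
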